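(* Let $p$ be an odd prime and let $a,b,c$ be integers with $0<a,b,c<p$. (i) If $a+b+2c<3p-1$, then $S(a,b,c;1,3)=0$. In particular, if $2c<p$, then $S(a,b,c;1,3)=0$. (ii) If $a+b+2c\ge 3p-1$, then in $\mathbb F_p$ $$\bar S(a,b,c;1,3)=\frac{(2c-1-p)!}{(c-1)!}\,\frac{a!\,(a+c-p)!\,b!\,(b+c-p)!}{(a+b+c-2p+1)!\,(a+b+2c-3p+1)!}.$$
   Context: For non-negative integers $a,b,c$ let $\Phi(x_1,x_2;a,b,c)=(x_1-x_2)^{2c}\,x_1^a x_2^a(1-x_1)^b(1-x_2)^b\in\mathbb Z[x_1,x_2]$. For positive integers $l_1,l_2$, let $S(a,b,c;l_1,l_2)\in\mathbb Z$ be the coefficient of $x_1^{l_1p-1}x_2^{l_2p-1}$ in $\Phi(x_1,x_2;a,b,c)$, and let $\bar S(a,b,c;l_1,l_2)\in\mathbb F_p$ be its reduction modulo $p$. Factorials are factorials of non-negative integers, projected to $\mathbb F_p$, and quotients are taken in $\mathbb F_p$. *)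

theory Defs
  imports
    "HOL-Number_Theory.Residues"
    "HOL-Computational_Algebra.Polynomial"
begin

(* Z[x1,x2] is represented as (Z[x1])[x2], i.e. by the type int poly poly:
   the inner variable is x1, the outer variable is x2. *)

definition X1 :: "int poly poly" where
  "X1 = [:[:0, 1:]:]"

definition X2 :: "int poly poly" where
  "X2 = [:0, 1:]"

definition Phi :: "nat \<Rightarrow> nat \<Rightarrow> nat \<Rightarrow> int poly poly" where
  "Phi a b c = (X1 - X2) ^ (2 * c) * X1 ^ a * X2 ^ a * (1 - X1) ^ b * (1 - X2) ^ b"

(* The outer coefficient selects the power of x2, the inner one the power of x1.
   Meant for positive l1, l2, p, so that the subtractions do not truncate. *)
definition S_coeff :: "nat \<Rightarrow> nat \<Rightarrow> nat \<Rightarrow> nat \<Rightarrow> nat \<Rightarrow> nat \<Rightarrow> int" where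
  "S_coeff p a b c l1 l2 =
     Polynomial.coeff (Polynomial.coeff (Phi a b c) (l2 * p - 1)) (l1 * p - 1)"

(* For a prime p this is the field with p elements, with carrier {0..p-1}. *)
abbreviation F :: "nat \<Rightarrow> int ring" where
  "F p \<equiv> residue_ring (int p)"

definition reduce :: "nat \<Rightarrow> int \<Rightarrow> int" where
  "reduce p z = z mod int p"

definition S_bar :: "nat \<Rightarrow> nat \<Rightarrow> nat \<Rightarrow> nat \<Rightarrow> nat \<Rightarrow> nat \<Rightarrow> int" where
  "S_bar p a b c l1 l2 = reduce p (S_coeff p a b c l1 l2)"

definition fact_F :: "nat \<Rightarrow> nat \<Rightarrow> int" where
  "fact_F p n = reduce p (fact n)"

(* Only meaningful if y is a unit of R; inv is otherwise unspecified. *)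
definition quot :: "('a, 'b) monoid_scheme \<Rightarrow> 'a \<Rightarrow> 'a \<Rightarrow> 'a" (infixl "\<oslash>\<index>" 70) where
  "x \<oslash>\<^bsub>R\<^esub> y = x \<otimes>\<^bsub>R\<^esub> inv\<^bsub>R\<^esub> y"

end

theory Submission
  imports Defs
begin

text \<open>
  Expanding \<open>(x1 - x2)^(2c)\<close> writes the coefficient as the sum over \<open>i\<close> of
  \<open>(-1)^i C(2c, i) C(b, n - i) C(b, m - i)\<close> with \<open>n = p - 1 - a\<close> and \<open>m = a + b + 2c - 3p + 1\<close>.
  Here \<open>b\<close> is congruent to \<open>n + m - 2c\<close> modulo \<open>p\<close>, so the sum is, modulo \<open>p\<close>, the well-poised
  terminating hypergeometric sum of Dixon, evaluated in closed form by the Wilf-Zeilberger method.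
  Wilson's theorem in the form \<open>k! (p - 1 - k)! = (-1)^(k + 1)\<close> turns the closed form into the
  stated quotient of factorials.
\<close>

subsection \<open>Dixon's identity\<close>

text \<open>The summand of \<open>dixon_binomial_sum\<close> times \<open>n! m! (2c - 1 - n - m)!^2 / (2c)!\<close>, in a form that
  vanishes for \<open>i > n\<close> and \<open>i > m\<close>, where \<open>n - i\<close> and \<open>m - i\<close> would be truncated.\<close>

definition dixon_term :: "nat \<Rightarrow> nat \<Rightarrow> nat \<Rightarrow> nat \<Rightarrow> real" where
  "dixon_term c n m i =
     (- 1) ^ i * real (n choose i) * real (m choose i) * fact i *
     fact (2 * c - m - 1 - i) * fact (2 * c - n - 1 - i) / fact (2 * c - i)"

text \<open>The Wilf-Zeilberger certificate, read off from partial sums in small cases. Its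
  factor \<open>Suc m choose i\<close> is \<open>(m choose i) / (m + 1 - i)\<close> times \<open>m + 1\<close>, written so that it has no
  pole at \<open>i = m + 1\<close>.\<close>

definition dixon_cert :: "nat \<Rightarrow> nat \<Rightarrow> nat \<Rightarrow> nat \<Rightarrow> real" where
  "dixon_cert c n m i =
     - (real i * (2 * real c - real n - real i) / (2 * (real m + 1))) *
     ((- 1) ^ i * real (n choose i) * real (Suc m choose i) * fact i *
      fact (2 * c - m - 1 - i) * fact (2 * c - n - 1 - i) / fact (2 * c - i))"

text \<open>Real subtraction keeps absorption valid for every \<open>i\<close>: at
  \<open>i = m + 1\<close> the linear factor vanishes, and beyond that both binomials do.\<close>

lemma binomial_absorb_real:
  "(real m + 1 - real i) * real (Suc m choose i) = (real m + 1) * real (m choose i)"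
proof (cases "i \<le> m")
  case True
  then have "(Suc m - i) * (Suc m choose i) = Suc m * (m choose i)"
    using binomial_absorb_comp[of "Suc m" i] by simp
  then have "real (Suc m - i) * real (Suc m choose i) = real (Suc m) * real (m choose i)"
    by (metis of_nat_mult)
  with True show ?thesis by (simp add: of_nat_diff algebra_simps)
next
  case False
  then show ?thesis by (cases "i = Suc m") (auto simp: binomial_eq_0)
qed

lemma binomial_step_real:
  "(real i + 1) * real (n choose Suc i) = (real n - real i) * real (n choose i)"
proof (cases n)
  case (Suc k)
  have "Suc i * (Suc k choose Suc i) = Suc k * (k choose i)"
    by (rule Suc_times_binomial)
  then have "real (Suc i) * real (Suc k choose Suc i) = real (Suc k) * real (k choose i)"
    by (metis of_nat_mult)
  then show ?thesis
    using binomial_absorb_real[of k i] Suc by (simp add: algebra_simps)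
qed (cases i, auto)

text \<open>The two coefficients are the numerator and denominator of the ratio of consecutive
  closed forms in \<open>m\<close>. All four terms turn out to be rational multiples of one product
  \<open>P\<close>, so the claim reduces to a polynomial identity.\<close>

lemma dixon_telescope:
  assumes "n + Suc m < c"
  shows "(2 * real c - 1 - real n - real m) * (real c - 1 - real m) * dixon_term c n (Suc m) i
         - (real c - 1 - real n - real m) * dixon_term c n m i
         = dixon_cert c n m (Suc i) - dixon_cert c n m i"
proof (cases "i \<le> n")
  case False
  then show ?thesis by (simp add: dixon_term_def dixon_cert_def binomial_eq_0)
next
  case True
  define A where "A = real (n choose i)"
  define B where "B = real (Suc m choose i)"
  \<comment> \<open>These are the factorials of the certificate at \<open>i + 1\<close>; those at
    \<open>i\<close> differ from them by linear factors, and \<open>i \<le> n\<close> keeps all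
    arguments free of truncation.\<close>
  define U :: real where "U = fact (2 * c - m - 2 - i)"
  define V :: real where "V = fact (2 * c - n - 2 - i)"
  define W :: real where "W = fact (2 * c - Suc i)"
  have W0: "W \<noteq> 0" by (simp add: W_def)
  have e1: "2 * c - m - 1 - i = Suc (2 * c - m - 2 - i)"
    and e2: "2 * c - n - 1 - i = Suc (2 * c - n - 2 - i)"
    and e3: "2 * c - i = Suc (2 * c - Suc i)"
    using assms True by linarith+
  have f1: "fact (2 * c - m - 1 - i) = (2 * real c - real m - 1 - real i) * U"
    unfolding e1 U_def fact_Suc using assms True by (simp add: of_nat_diff)
  have f2: "fact (2 * c - n - 1 - i) = (2 * real c - real n - 1 - real i) * V"
    unfolding e2 V_def fact_Suc using assms True by (simp add: of_nat_diff)
  have f3: "fact (2 * c - i) = (2 * real c - real i) * W"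
    unfolding e3 W_def fact_Suc using assms True by (simp add: of_nat_diff)
  have c0: "2 * real c - real i \<noteq> 0" using assms True by linarith
  have b1: "real (m choose i) = (real m + 1 - real i) * B / (real m + 1)"
    using binomial_absorb_real[of m i] by (simp add: B_def field_simps)
  have b2: "real (n choose Suc i) = (real n - real i) * A / (real i + 1)"
    using binomial_step_real[of i n] by (simp add: A_def field_simps)
  have b3: "real (Suc m choose Suc i) = (real m + 1 - real i) * B / (real i + 1)"
    using binomial_step_real[of i "Suc m"] by (simp add: B_def field_simps)
  define P where "P = (- 1) ^ i * A * B * fact i * U * V / ((2 * real c - real i) * W)"
  have t1: "dixon_term c n (Suc m) i = P * (2 * real c - real n - 1 - real i)"
    unfolding dixon_term_def f2 f3 A_def[symmetric] B_def[symmetric] P_def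
    by (simp add: U_def)
  have t2: "dixon_term c n m i = P * ((real m + 1 - real i) / (real m + 1)) *
      (2 * real c - real m - 1 - real i) * (2 * real c - real n - 1 - real i)"
    unfolding dixon_term_def f1 f2 f3 b1 A_def[symmetric] P_def by (simp add: mult_ac)
  have t3: "dixon_cert c n m i = - (real i * (2 * real c - real n - real i) / (2 * (real m + 1))) *
      P * (2 * real c - real m - 1 - real i) * (2 * real c - real n - 1 - real i)"
    unfolding dixon_cert_def f1 f2 f3 A_def[symmetric] B_def[symmetric] P_def by (simp add: mult_ac)
  have t4: "dixon_cert c n m (Suc i) = (2 * real c - real n - real i - 1) / (2 * (real m + 1)) *
      P * (2 * real c - real i) * (real n - real i) * (real m + 1 - real i)"
  proof -
    have g: "fact (2 * c - m - 1 - Suc i) = U" "fact (2 * c - n - 1 - Suc i) = V"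
      by (simp_all add: U_def V_def)
    \<comment> \<open>As a single nonzero symbol \<open>j\<close> cancels: one factor from the
      certificate and one from \<open>fact (Suc i)\<close> against the two binomial
      denominators.\<close>
    define j where "j = real i + 1"
    have j0: "j \<noteq> 0" by (simp add: j_def add_nonneg_eq_0_iff)
    have "dixon_cert c n m (Suc i) =
      - (j * (2 * real c - real n - j) / (2 * (real m + 1))) *
      ((- 1) ^ Suc i * ((real n - real i) * A / j) *
       ((real m + 1 - real i) * B / j) * (j * fact i) * U * V / W)"
      unfolding dixon_cert_def b2 b3 g W_def[symmetric] by (simp add: j_def add_ac)
    also have "\<dots> = (2 * real c - real n - j) / (2 * (real m + 1)) *
      ((- 1) ^ i * A * B * fact i * U * V / W) * (real n - real i) * (real m + 1 - real i)"
      using j0 by simp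
    also have "(- 1) ^ i * A * B * fact i * U * V / W = P * (2 * real c - real i)"
      using c0 by (simp add: P_def)
    finally show ?thesis by (simp add: j_def mult_ac diff_diff_eq)
  qed
  have m0: "real m + 1 \<noteq> 0" by linarith
  show ?thesis
    unfolding t1 t2 t3 t4 using m0 by (simp add: divide_simps) (simp add: algebra_simps)
qed

text \<open>Summing the telescoping relation over \<open>i\<close> leaves a first-order recurrence
  in \<open>m\<close> that the closed form also satisfies; for \<open>m = 0\<close> the sum is a
  single term.\<close>

lemma dixon_sum:
  assumes "n + m < c"
  shows "(\<Sum>i\<le>m. dixon_term c n m i) =
    fact (2 * c - 1 - n - m) * fact (2 * c - 1) * fact (c - 1 - n) * fact (c - 1 - m)
    / (fact (c - 1) * fact (2 * c) * fact (c - 1 - n - m))"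
  using assms
proof (induction m)
  case 0
  then show ?case by (simp add: dixon_term_def)
next
  case (Suc m)
  let ?a = "(2 * real c - 1 - real n - real m) * (real c - 1 - real m)"
  let ?b = "real c - 1 - real n - real m"
  have a0: "?a \<noteq> 0" using Suc.prems by auto
  have "?a * (\<Sum>i\<le>Suc m. dixon_term c n (Suc m) i) - ?b * (\<Sum>i\<le>Suc m. dixon_term c n m i)
      = (\<Sum>i\<le>Suc m. dixon_cert c n m (Suc i) - dixon_cert c n m i)"
    by (simp only: dixon_telescope[OF Suc.prems, symmetric] sum_subtractf sum_distrib_left)
  also have "\<dots> = dixon_cert c n m (Suc (Suc m)) - dixon_cert c n m 0"
    unfolding lessThan_Suc_atMost[symmetric] by (rule sum_lessThan_telescope)
  \<comment> \<open>The certificate vanishes at \<open>0\<close> through its factor \<open>i\<close>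
    and at \<open>m + 2\<close> through \<open>Suc m choose i\<close>.\<close>
  also have "\<dots> = 0" by (simp add: dixon_cert_def binomial_eq_0)
  also have "(\<Sum>i\<le>Suc m. dixon_term c n m i) = (\<Sum>i\<le>m. dixon_term c n m i)"
    by (simp add: dixon_term_def)
  finally have rec: "?a * (\<Sum>i\<le>Suc m. dixon_term c n (Suc m) i) = ?b * (\<Sum>i\<le>m. dixon_term c n m i)"
    by simp
  \<comment> \<open>The factorial arguments at \<open>Suc m\<close>; those at \<open>m\<close> are
    their successors, which exhibits the ratio of the closed forms.\<close>
  define x y z where "x = 2 * c - 1 - n - Suc m" and "y = c - 1 - Suc m" and "z = c - 1 - n - Suc m"
  have e: "2 * c - 1 - n - m = Suc x" "c - 1 - m = Suc y" "c - 1 - n - m = Suc z"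
    using Suc.prems by (simp_all add: x_def y_def z_def)
  have r: "2 * real c - 1 - real n - real m = real x + 1" "real c - 1 - real m = real y + 1"
      "real c - 1 - real n - real m = real z + 1"
    using Suc.prems by (simp_all add: x_def y_def z_def of_nat_diff)
  have IH: "(\<Sum>i\<le>m. dixon_term c n m i) =
      ((real x + 1) * fact x) * fact (2 * c - 1) * fact (c - 1 - n) * ((real y + 1) * fact y)
      / (fact (c - 1) * fact (2 * c) * ((real z + 1) * fact z))"
    using Suc.IH Suc.prems unfolding e fact_Suc by (simp add: add.commute)
  have "(real x + 1) * (real y + 1) * (\<Sum>i\<le>Suc m. dixon_term c n (Suc m) i) =
      (real x + 1) * (real y + 1) * (fact x * fact (2 * c - 1) * fact (c - 1 - n) * fact y
      / (fact (c - 1) * fact (2 * c) * fact z))"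
    using rec unfolding r IH by (simp add: mult_ac add_nonneg_eq_0_iff)
  moreover have "(real x + 1) * (real y + 1) \<noteq> 0" by auto
  ultimately show ?case unfolding x_def y_def z_def by (metis mult_left_cancel)
qed

text \<open>An integral form fit for reduction modulo \<open>p\<close>. The Pochhammer symbol stands
  for \<open>(2c - 1)! / (2c - 1 - n - m)!\<close>: in the application
  \<open>2c - 1 - n - m = 2p - 1 - b \<ge> p\<close>, so both factorials are divisible by
  \<open>p\<close> and must be cancelled beforehand.\<close>

lemma dixon_binomial_sum:
  fixes n m c :: nat
  assumes "n + m < c"
  shows "(\<Sum>i\<le>min n m. (- 1) ^ i * int (2 * c choose i) * int ((2 * c - m - 1 - i) choose (n - i)) *
        int ((2 * c - n - 1 - i) choose (m - i)))
      * (fact n * fact m * fact (c - 1) * fact (c - 1 - n - m))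
    = pochhammer (int (2 * c - n - m)) (n + m) * fact (c - 1 - n) * fact (c - 1 - m)"
    (is "?T * ?L = ?P * _ * _")
proof -
  \<comment> \<open>For every \<open>i\<close>, upper minus lower entry equals \<open>E\<close> in
    both of the last two binomials.\<close>
  define E where "E = 2 * c - 1 - n - m"
  have t: "real_of_int ((- 1) ^ i * int (2 * c choose i) * int ((2 * c - m - 1 - i) choose (n - i)) *
        int ((2 * c - n - 1 - i) choose (m - i))) * (fact n * fact m * fact E * fact E)
      = fact (2 * c) * dixon_term c n m i" if "i \<le> min n m" for i
  proof -
    have i: "i \<le> n" "i \<le> m" using that by auto
    have e: "2 * c - m - 1 - i - (n - i) = E" "2 * c - n - 1 - i - (m - i) = E"
      using i assms by (auto simp: E_def)
    have "real (2 * c choose i) = fact (2 * c) / (fact i * fact (2 * c - i))"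
      by (rule binomial_fact) (use i assms in linarith)
    moreover have "real ((2 * c - m - 1 - i) choose (n - i)) =
        fact (2 * c - m - 1 - i) / (fact (n - i) * fact E)"
      unfolding e(1)[symmetric] by (rule binomial_fact) (use i assms in linarith)
    moreover have "real ((2 * c - n - 1 - i) choose (m - i)) =
        fact (2 * c - n - 1 - i) / (fact (m - i) * fact E)"
      unfolding e(2)[symmetric] by (rule binomial_fact) (use i assms in linarith)
    moreover have "real (n choose i) = fact n / (fact i * fact (n - i))"
      by (rule binomial_fact) (use i in linarith)
    moreover have "real (m choose i) = fact m / (fact i * fact (m - i))"
      by (rule binomial_fact) (use i in linarith)
    ultimately show ?thesis by (simp add: dixon_term_def mult_ac)
  qed
  have "real_of_int ?T * (fact n * fact m * fact E * fact E)
      = fact (2 * c) * (\<Sum>i\<le>min n m. dixon_term c n m i)"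
    unfolding of_int_sum sum_distrib_left sum_distrib_right by (rule sum.cong) (use t in auto)
  also have "(\<Sum>i\<le>min n m. dixon_term c n m i) = (\<Sum>i\<le>m. dixon_term c n m i)"
    by (rule sum.mono_neutral_left) (auto simp: dixon_term_def)
  finally have "real_of_int ?T * (fact n * fact m * fact E * fact E) * (fact (c - 1) * fact (c - 1 - n - m))
      = fact E * fact (2 * c - 1) * fact (c - 1 - n) * fact (c - 1 - m)"
    by (simp add: dixon_sum[OF assms] E_def add_ac)
  also have "(fact (2 * c - 1) :: real) = fact E * pochhammer (real E + 1) (n + m)"
  proof -
    have "2 * c - 1 = E + (n + m)" using assms by (simp add: E_def)
    then show ?thesis
      unfolding pochhammer_fact using pochhammer_product'[of "1::real" E "n + m"]
      by (simp add: add.commute)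
  qed
  also have "pochhammer (real E + 1) (n + m) = real_of_int ?P"
  proof -
    have "real E + 1 = real (2 * c - n - m)" using assms by (simp add: E_def)
    then show ?thesis by (simp only: pochhammer_of_int[symmetric] of_int_of_nat_eq)
  qed
  finally have "(fact E * fact E) * (real_of_int ?T * (fact n * fact m * fact (c - 1) * fact (c - 1 - n - m)))
      = (fact E * fact E) * (real_of_int ?P * fact (c - 1 - n) * fact (c - 1 - m))"
    by (simp only: mult_ac)
  moreover have "fact E * fact E \<noteq> (0 :: real)" by simp
  ultimately have "real_of_int ?T * (fact n * fact m * fact (c - 1) * fact (c - 1 - n - m))
      = real_of_int ?P * fact (c - 1 - n) * fact (c - 1 - m)"
    using mult_left_cancel by blast
  then have "real_of_int (?T * ?L) = real_of_int (?P * fact (c - 1 - n) * fact (c - 1 - m))"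
    by (simp only: of_int_mult of_int_fact)
  then show ?thesis by (simp only: of_int_eq_iff)
qed

subsection \<open>Coefficients of the master polynomial\<close>

lemma coeff_X_power_mult:
  fixes q :: "'a::comm_ring_1 poly"
  shows "coeff ([:0, 1:] ^ k * q) j = (if k \<le> j then coeff q (j - k) else 0)"
proof -
  have "[:0, 1:] ^ k = monom (1::'a) k" by (simp add: monom_altdef)
  then show ?thesis by (simp add: coeff_monom_mult not_le)
qed

lemma coeff_one_minus_X_power:
  "coeff ((1 - [:0, 1:] :: 'a::comm_ring_1 poly) ^ b) j = (- 1) ^ j * of_nat (b choose j)"
proof -
  have "(1 - [:0, 1:] :: 'a poly) ^ b = (\<Sum>k\<le>b. of_nat (b choose k) * (- [:0, 1:]) ^ k * 1 ^ (b - k))"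
    using binomial_ring[of "- [:0, 1:] :: 'a poly" 1 b] by (simp only: uminus_add_conv_diff)
  also have "\<dots> = (\<Sum>k\<le>b. monom ((- 1) ^ k * of_nat (b choose k)) k)"
  proof (rule sum.cong)
    fix k
    have "(- [:0, 1:] :: 'a poly) ^ k = smult ((- 1) ^ k) ([:0, 1:] ^ k)"
      using smult_power[of "- 1 :: 'a" "[:0, 1:]" k] by simp
    then show "of_nat (b choose k) * (- [:0, 1:]) ^ k * 1 ^ (b - k)
        = monom ((- 1) ^ k * of_nat (b choose k) :: 'a) k"
      by (simp add: monom_altdef of_nat_poly mult.commute)
  qed simp
  finally show ?thesis
    by (simp add: coeff_sum binomial_eq_0)
qed

text \<open>Each summand separates the variables: the scalar of \<open>smult\<close> is a polynomial
  in x1, the other factor one in x2. Hence its coefficients are products of coefficients in one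
  variable.\<close>

lemma Phi_expand:
  "Phi a b c = (\<Sum>i\<le>2*c. smult ([:of_int ((- 1) ^ i * int (2 * c choose i)):] *
      ([:0, 1:] ^ (a + i) * (1 - [:0, 1:]) ^ b))
      ([:0, 1:] ^ (a + (2 * c - i)) * (1 - [:0, 1:]) ^ b))"
proof -
  have X1p: "X1 ^ k = [:[:0, 1:] ^ k:]" for k
    by (induction k) (simp_all add: X1_def one_pCons)
  have X1q: "(1 - X1) ^ k = [:(1 - [:0, 1:]) ^ k:]" for k
    by (induction k) (simp_all add: X1_def one_pCons)
  \<comment> \<open>The even exponent permits the swap, which attaches the alternating sign to the
    powers of \<open>X1\<close>.\<close>
  have "(X1 - X2) ^ (2 * c) = (X2 - X1) ^ (2 * c)"
    by (metis minus_diff_eq power2_minus power_mult)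
  also have "\<dots> = (\<Sum>i\<le>2*c. of_nat (2 * c choose i) * (- X1) ^ i * X2 ^ (2 * c - i))"
    using binomial_ring[of "- X1" X2 "2*c"] by simp
  finally have e: "Phi a b c = (\<Sum>i\<le>2*c. of_nat (2 * c choose i) * (- X1) ^ i * X2 ^ (2 * c - i)
      * X1 ^ a * X2 ^ a * (1 - X1) ^ b * (1 - X2) ^ b)"
    by (simp only: Phi_def sum_distrib_right)
  show ?thesis
    unfolding e
  proof (rule sum.cong)
    fix i
    let ?s = "(- 1) ^ i * of_nat (2 * c choose i) :: int poly poly"
    have "of_nat (2 * c choose i) * (- X1) ^ i * X2 ^ (2 * c - i)
        * X1 ^ a * X2 ^ a * (1 - X1) ^ b * (1 - X2) ^ b
        = ?s * (X1 ^ (a + i) * (1 - X1) ^ b) * (X2 ^ (a + (2 * c - i)) * (1 - X2) ^ b)"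
      by (simp add: power_minus[of X1] power_add mult_ac)
    also have "?s = [:[:of_int ((- 1) ^ i * int (2 * c choose i)):]:]"
      by (cases "even i") (simp_all add: of_nat_poly)
    finally show "of_nat (2 * c choose i) * (- X1) ^ i * X2 ^ (2 * c - i)
        * X1 ^ a * X2 ^ a * (1 - X1) ^ b * (1 - X2) ^ b =
      smult ([:of_int ((- 1) ^ i * int (2 * c choose i)):] *
      ([:0, 1:] ^ (a + i) * (1 - [:0, 1:]) ^ b))
      ([:0, 1:] ^ (a + (2 * c - i)) * (1 - [:0, 1:]) ^ b)"
      unfolding X1p X1q X2_def by (simp add: mult_ac)
  qed simp
qed

lemma coeff_coeff_Phi:
  assumes "a \<le> s" "a + 2 * c \<le> t"
  shows "coeff (coeff (Phi a b c) t) s =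
    (\<Sum>i\<le>s - a. (- 1) ^ (s + t + i) * int (2 * c choose i) * int (b choose (s - a - i))
       * int (b choose (t - a - 2 * c + i)))"
proof -
  have "coeff (coeff (Phi a b c) t) s = (\<Sum>i\<le>2*c. if i \<le> s - a then
      (- 1) ^ (s + t + i) * int (2 * c choose i) * int (b choose (s - a - i))
       * int (b choose (t - a - 2 * c + i)) else 0)"
    unfolding Phi_expand coeff_sum
  proof (rule sum.cong)
    fix i assume i: "i \<in> {..2*c}"
    have s1: "t - (a + (2 * c - i)) = t - a - 2 * c + i" using i assms by auto
    have k: "(- 1) ^ k * of_nat l = [:(- 1) ^ k * int l:]" for k l
      by (cases "even k") (simp_all add: of_nat_poly)
    \<comment> \<open>The exponents on the left sum to \<open>s + t + i\<close> minus the even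
      number \<open>2a + 2c\<close>.\<close>
    have s2: "(- 1) ^ i * ((- 1) ^ (s - (a + i)) * (- 1) ^ (t - a - 2 * c + i)) = (- 1 :: int) ^ (s + t + i)"
      if le: "a + i \<le> s"
    proof -
      obtain u where u: "s = a + i + u" using le_Suc_ex[OF le] by blast
      obtain v where v: "t = a + 2 * c + v" using le_Suc_ex[OF assms(2)] by blast
      show ?thesis unfolding u v by (auto simp: minus_one_power_iff)
    qed
    have s3: "a + (2 * c - i) \<le> t" using assms i by auto
    show "coeff (coeff (smult ([:of_int ((- 1) ^ i * int (2 * c choose i)):] *
      ([:0, 1:] ^ (a + i) * (1 - [:0, 1:]) ^ b))
      ([:0, 1:] ^ (a + (2 * c - i)) * (1 - [:0, 1:]) ^ b)) t) s = (if i \<le> s - a then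
      (- 1) ^ (s + t + i) * int (2 * c choose i) * int (b choose (s - a - i))
       * int (b choose (t - a - 2 * c + i)) else 0)"
    proof (cases "a + i \<le> s")
      case True
      then have i': "i \<le> s - a" by simp
      show ?thesis
        unfolding coeff_smult coeff_X_power_mult coeff_one_minus_X_power if_P[OF s3] s1 k
          if_P[OF i'] s2[OF True, symmetric] using True
        by (simp add: coeff_X_power_mult coeff_one_minus_X_power)
    next
      case False
      then have i': "\<not> i \<le> s - a" using assms by simp
      show ?thesis
        unfolding coeff_smult coeff_X_power_mult coeff_one_minus_X_power if_P[OF s3] s1 k
          if_not_P[OF i'] using False
        by (simp add: coeff_X_power_mult)
    qed
  qed simp
  also have "\<dots> = (\<Sum>i\<in>{..2*c} \<inter> {i. i \<le> s - a}. (- 1) ^ (s + t + i) * int (2 * c choose i) *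
      int (b choose (s - a - i)) * int (b choose (t - a - 2 * c + i)))"
    by (rule sum.inter_restrict[symmetric, where A="{..2*c}" and B="{i. i \<le> s - a}", simplified])
  also have "\<dots> = (\<Sum>i\<le>s - a. (- 1) ^ (s + t + i) * int (2 * c choose i) *
      int (b choose (s - a - i)) * int (b choose (t - a - 2 * c + i)))"
    \<comment> \<open>If \<open>s - a\<close> exceeds \<open>2c\<close>, the added terms vanish
      because \<open>2 * c choose i\<close> is zero there.\<close>
    by (rule sum.mono_neutral_left) auto
  finally show ?thesis .
qed

subsection \<open>Reduction modulo p\<close>

text \<open>Upper negation, \<open>C(-1 - e, k) = (-1)^k C(e + k, k)\<close>, read modulo
  \<open>p\<close>. The bound \<open>k < p\<close> makes each divisor \<open>k + 1\<close> met in
  the induction invertible.\<close>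

lemma binomial_neg_cong:
  fixes p b e k :: nat
  assumes "prime p" "k < p" "[int b + int e = - 1] (mod int p)"
  shows "[int (b choose k) = (- 1) ^ k * int ((e + k) choose k)] (mod int p)"
  using assms(2)
proof (induction k)
  case 0
  then show ?case by simp
next
  case (Suc k)
  have b: "int (Suc k) * int (b choose Suc k) = (int b - int k) * int (b choose k)"
  proof (cases "k \<le> b")
    case True
    then have "Suc k * (b choose Suc k) = (b - k) * (b choose k)"
      by (metis binomial_absorb_comp binomial_absorption mult.commute)
    then show ?thesis using True by (metis of_nat_mult of_nat_diff)
  qed (simp add: binomial_eq_0)
  have "Suc k * ((e + Suc k) choose Suc k) = Suc (e + k) * ((e + k) choose k)"
    using Suc_times_binomial[of k "e + k"] by (simp only: add_Suc_right)
  then have e: "int (Suc k) * int ((e + Suc k) choose Suc k) = int (Suc (e + k)) * int ((e + k) choose k)"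
    by (metis of_nat_mult)
  have "int (Suc k) * ((- 1) ^ Suc k * int ((e + Suc k) choose Suc k)) =
      (- 1) ^ Suc k * (int (Suc k) * int ((e + Suc k) choose Suc k))"
    by (simp only: mult.left_commute)
  also have "\<dots> = - (int e + int k + 1) * ((- 1) ^ k * int ((e + k) choose k))"
    unfolding e by (simp add: algebra_simps)
  finally have e': "int (Suc k) * ((- 1) ^ Suc k * int ((e + Suc k) choose Suc k)) =
      - (int e + int k + 1) * ((- 1) ^ k * int ((e + k) choose k))" .
  have "[(int b - int k) * int (b choose k) =
      (- (int e + int k + 1)) * ((- 1) ^ k * int ((e + k) choose k))] (mod int p)"
  proof (rule cong_mult)
    have "int b - int k - (- (int e + int k + 1)) = int b + int e - (- 1)" by simp
    then show "[int b - int k = - (int e + int k + 1)] (mod int p)"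
      using assms(3) by (simp only: cong_iff_dvd_diff)
    show "[int (b choose k) = (- 1) ^ k * int ((e + k) choose k)] (mod int p)"
      using Suc by simp
  qed
  then have "[int (Suc k) * int (b choose Suc k) =
      int (Suc k) * ((- 1) ^ Suc k * int ((e + Suc k) choose Suc k))] (mod int p)"
    unfolding b e' .
  moreover have "coprime (int (Suc k)) (int p)"
    using assms(1) Suc.prems
    by (metis coprime_commute coprime_int_iff nat_dvd_not_less prime_imp_coprime zero_less_Suc)
  ultimately show ?case using cong_mult_lcancel by blast
qed

text \<open>Starting from Wilson's theorem at \<open>k = 0\<close>, each step moves one factor
  across, using \<open>p - 1 - k = -(k + 1)\<close> modulo \<open>p\<close>.\<close>

lemma wilson_pair:
  fixes p k :: nat
  assumes "prime p" "k < p"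
  shows "[fact k * fact (p - 1 - k) = (- 1) ^ Suc k] (mod int p)"
  using assms(2)
proof (induction k)
  case 0
  then show ?case using wilson_theorem[OF assms(1)] by simp
next
  case (Suc k)
  have e: "p - 1 - k = Suc (p - 1 - Suc k)" using Suc.prems by simp
  have IH: "[fact k * fact (p - 1 - k) = (- 1) ^ Suc k] (mod int p)" using Suc by simp
  have f: "(fact (p - 1 - k) :: int) = (int p - 1 - int k) * fact (p - 1 - Suc k)"
    unfolding e fact_Suc using Suc.prems by (simp add: of_nat_diff)
  have "[fact (Suc k) * fact (p - 1 - Suc k) = - (fact k * fact (p - 1 - k))] (mod int p)"
    unfolding f fact_Suc cong_iff_dvd_diff
    by (rule dvdI[where k = "fact k * fact (p - 1 - Suc k)"]) (simp add: algebra_simps)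
  also have "[- (fact k * fact (p - 1 - k)) = (- 1) ^ Suc (Suc k)] (mod int p)"
    using IH cong_minus_minus_iff by fastforce
  finally show ?case .
qed

lemma pochhammer_cong:
  fixes x y m :: int
  assumes "[x = y] (mod m)"
  shows "[pochhammer x k = pochhammer y k] (mod m)"
  by (induction k) (auto simp: pochhammer_Suc intro!: cong_mult cong_add assms)

lemma not_dvd_fact_int:
  fixes p k :: nat
  assumes "prime p" "k < p"
  shows "\<not> int p dvd fact k"
  using assms prime_dvd_fact_iff[of p k] by (metis int_dvd_int_iff not_le of_nat_fact)

text \<open>Characterises the field quotient by a congruence of integers, so that the final formula
  can be checked after clearing denominators.\<close>

lemma quot_residue_ring:
  fixes p :: nat and x y :: int
  assumes "prime p" "0 \<le> y" "y < int p" "\<not> int p dvd y"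
  shows "[(x \<oslash>\<^bsub>F p\<^esub> y) * y = x] (mod int p)"
proof -
  interpret R: residues_prime p "F p" by (simp_all add: residues_prime_def assms)
  have "y \<in> Units (F p)"
    using assms R.field_Units by (auto simp: residue_ring_def)
  then have "(inv\<^bsub>F p\<^esub> y * y) mod int p = 1"
    using R.Units_l_inv[of y] by (simp add: residue_ring_def)
  then have "[x * (inv\<^bsub>F p\<^esub> y * y) = x * 1] (mod int p)"
    using prime_gt_1_nat[OF assms(1)] by (intro cong_mult cong_refl) (simp add: cong_def)
  then show ?thesis
    by (simp add: quot_def residue_ring_def cong_def mod_mult_left_eq mult.assoc)
qed

section \<open>The coefficient for \<open>l1 = 1\<close>, \<open>l2 = 3\<close> and its closed form
  modulo \<open>p\<close>\<close>

lemma S_coeff_1_3: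
  fixes p a b c :: nat
  assumes "a < p" "c < p"
  shows "S_coeff p a b c 1 3 = (\<Sum>i\<le>p - 1 - a. (- 1) ^ i * int (2 * c choose i) *
    int (b choose (p - 1 - a - i)) * int (b choose (3 * p - 1 - a - 2 * c + i)))"
proof -
  \<comment> \<open>The two exponents have even sum \<open>4p - 2\<close>, so only the sign
    \<open>(-1)^i\<close> survives.\<close>
  have "1 * p - 1 + (3 * p - 1) = 2 * (2 * p - 1)" using assms by auto
  then have "(- 1 :: int) ^ (1 * p - 1 + (3 * p - 1) + i) = (- 1) ^ i" for i
    by (simp only: power_add power_mult) simp
  moreover have "a \<le> 1 * p - 1" "a + 2 * c \<le> 3 * p - 1" using assms by auto
  ultimately show ?thesis
    unfolding S_coeff_def by (simp only: coeff_coeff_Phi mult_1)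
qed

text \<open>Reflecting the last binomial turns its lower entry into \<open>m - i\<close>; upper
  negation of both binomials with upper entry \<open>b\<close> then yields exactly the Dixon
  sum.\<close>

lemma S_coeff_1_3_cong:
  fixes p a b c :: nat
  assumes p: "prime p" and a: "0 < a" "a < p" and b: "b < p" and c: "c < p"
    and ge: "3 * p - 1 \<le> a + b + 2 * c"
  defines "n \<equiv> p - 1 - a" and "m \<equiv> a + b + 2 * c + 1 - 3 * p"
  shows "[S_coeff p a b c 1 3 = (- 1) ^ b *
    (\<Sum>i\<le>min n m. (- 1) ^ i * int (2 * c choose i) * int ((2 * c - m - 1 - i) choose (n - i)) *
        int ((2 * c - n - 1 - i) choose (m - i)))] (mod int p)"
proof -
  have nm: "n + m + 2 * p = b + 2 * c" using assms by (auto simp: n_def m_def)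
  have mM: "m + (3 * p - 1 - a - 2 * c) = b" using assms by (auto simp: m_def)
  have n: "n < p" using a by (simp add: n_def)
  have m: "m < p" using mM b by linarith
  \<comment> \<open>Of the residues of \<open>-1 - b\<close>, the choice \<open>2p - 1 - b\<close>
    makes \<open>e + (n - i)\<close> and \<open>e + (m - i)\<close> equal to the upper entries in
    Dixon's sum.\<close>
  define e where "e = 2 * p - 1 - b"
  have "int b + int e = int p * 2 - 1" using b by (simp add: e_def of_nat_diff)
  then have be: "[int b + int e = - 1] (mod int p)"
    by (simp add: cong_iff_dvd_diff)
  have "S_coeff p a b c 1 3 = (\<Sum>i\<le>n. (- 1) ^ i * int (2 * c choose i) *
      int (b choose (n - i)) * int (b choose (3 * p - 1 - a - 2 * c + i)))"
    unfolding n_def by (rule S_coeff_1_3) fact+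
  also have "\<dots> = (\<Sum>i\<le>min n m. (- 1) ^ i * int (2 * c choose i) *
      int (b choose (n - i)) * int (b choose (3 * p - 1 - a - 2 * c + i)))"
  proof (rule sum.mono_neutral_right)
    show "\<forall>i\<in>{..n} - {..min n m}. (- 1) ^ i * int (2 * c choose i) *
      int (b choose (n - i)) * int (b choose (3 * p - 1 - a - 2 * c + i)) = 0"
    proof
      fix i assume "i \<in> {..n} - {..min n m}"
      then have "b < 3 * p - 1 - a - 2 * c + i" using mM by auto
      then show "(- 1) ^ i * int (2 * c choose i) *
          int (b choose (n - i)) * int (b choose (3 * p - 1 - a - 2 * c + i)) = 0"
        by (simp add: binomial_eq_0)
    qed
  qed auto
  finally have S_eq: "S_coeff p a b c 1 3 = (\<Sum>i\<le>min n m. (- 1) ^ i * int (2 * c choose i) *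
      int (b choose (n - i)) * int (b choose (3 * p - 1 - a - 2 * c + i)))" .
  show ?thesis
    unfolding S_eq sum_distrib_left
  proof (rule cong_sum)
    fix i assume "i \<in> {..min n m}"
    then have i: "i \<le> n" "i \<le> m" by auto
    obtain n' m' where n': "n = i + n'" and m': "m = i + m'"
      using i le_Suc_ex by metis
    have eb: "e + b + 1 = 2 * p" using b by (simp add: e_def)
    have e1: "e + (n - i) = 2 * c - m - 1 - i" and e2: "e + (m - i) = 2 * c - n - 1 - i"
      using nm eb unfolding n' m' by linarith+
    have "b - (m - i) = 3 * p - 1 - a - 2 * c + i" using mM i by linarith
    then have sym: "b choose (3 * p - 1 - a - 2 * c + i) = b choose (m - i)"
      using binomial_symmetric[of "m - i" b] mM by simp
    \<comment> \<open>The combined sign of the two negations has the parity of \<open>n + m\<close>,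
      which is that of \<open>b\<close>, independently of \<open>i\<close>.\<close>
    have "b + 2 * c = n - i + (m - i) + 2 * (i + p)" using nm unfolding n' m' by simp
    then have "even (b + 2 * c) = even (n - i + (m - i) + 2 * (i + p))" by (rule arg_cong)
    then have "even (n - i + (m - i)) = even b"
      by simp
    then have "(- 1 :: int) ^ (n - i + (m - i)) = (- 1) ^ b"
      by (cases "even b") simp_all
    then have s: "(- 1 :: int) ^ (n - i) * (- 1) ^ (m - i) = (- 1) ^ b"
      by (simp only: power_add)
    let ?s = "(- 1) ^ i * int (2 * c choose i)"
    let ?u = "int ((2 * c - m - 1 - i) choose (n - i))" and ?v = "int ((2 * c - n - 1 - i) choose (m - i))"
    have "[int (b choose (n - i)) = (- 1) ^ (n - i) * ?u] (mod int p)"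
      using binomial_neg_cong[OF p _ be, of "n - i"] n unfolding e1 by simp
    moreover have "[int (b choose (m - i)) = (- 1) ^ (m - i) * ?v] (mod int p)"
      using binomial_neg_cong[OF p _ be, of "m - i"] m unfolding e2 by simp
    ultimately have "[?s * int (b choose (n - i)) * int (b choose (m - i)) =
        ?s * ((- 1) ^ (n - i) * ?u) * ((- 1) ^ (m - i) * ?v)] (mod int p)"
      by (intro cong_mult cong_refl)
    also have "?s * ((- 1) ^ (n - i) * ?u) * ((- 1) ^ (m - i) * ?v) =
        ((- 1) ^ (n - i) * (- 1) ^ (m - i)) * (?s * ?u * ?v)"
      by (simp only: mult_ac)
    finally show "[?s * int (b choose (n - i)) * int (b choose (3 * p - 1 - a - 2 * c + i)) =
        (- 1) ^ b * (?s * ?u * ?v)] (mod int p)"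
      unfolding sym s .
  qed
qed

text \<open>The closed form with denominators cleared. The bound \<open>ge\<close>, with
  \<open>a\<close>, \<open>b\<close>, \<open>c\<close> below \<open>p\<close>, makes every natural
  subtraction in the statement exact.\<close>

lemma S_coeff_1_3_fact_cong:
  fixes p a b c :: nat
  assumes p: "prime p" "odd p" and a: "0 < a" "a < p" and b: "b < p" and c: "c < p"
    and ge: "3 * p - 1 \<le> a + b + 2 * c"
  shows "[S_coeff p a b c 1 3 *
      (fact (c - 1) * (fact (a + b + c + 1 - 2 * p) * fact (a + b + 2 * c + 1 - 3 * p)))
    = fact (2 * c - 1 - p) * (fact a * fact (a + c - p) * fact b * fact (b + c - p))] (mod int p)"
proof -
  define n where "n = p - 1 - a"
  define m where "m = a + b + 2 * c + 1 - 3 * p"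
  define X where "X = a + b + c + 1 - 2 * p"
  define Y where "Y = b + c - p"
  define T where "T = (\<Sum>i\<le>min n m. (- 1) ^ i * int (2 * c choose i) *
    int ((2 * c - m - 1 - i) choose (n - i)) * int ((2 * c - n - 1 - i) choose (m - i)))"
  have S: "[S_coeff p a b c 1 3 = (- 1) ^ b * T] (mod int p)"
    unfolding T_def n_def m_def by (rule S_coeff_1_3_cong) fact+
  \<comment> \<open>Since \<open>n + m = b + 2c - 2p\<close>, this amounts to
    \<open>b + c < 2p\<close>.\<close>
  have nmc: "n + m < c" using assms by (auto simp: n_def m_def)
  have e: "c - 1 - n = a + c - p" "c - 1 - m = p - 1 - X" "c - 1 - n - m = p - 1 - Y"
    using assms by (auto simp: n_def m_def X_def Y_def)
  have lt: "X < p" "Y < p" using assms by (auto simp: X_def Y_def)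
  define Q where "Q = pochhammer (int (2 * c - n - m)) (n + m)"
  have D: "T * (fact n * fact m * fact (c - 1) * fact (p - 1 - Y)) = Q * fact (a + c - p) * fact (p - 1 - X)"
    unfolding T_def Q_def e[symmetric] by (rule dixon_binomial_sum[OF nmc])
  \<comment> \<open>Modulo \<open>p\<close> the base \<open>2p - b\<close> of \<open>Q\<close>
    becomes \<open>p - b\<close>, so \<open>Q\<close> continues the factorial of
    \<open>p - 1 - b\<close> up to that of \<open>2c - 1 - p\<close>.\<close>
  have Qc: "[Q * fact (p - 1 - b) = fact (2 * c - 1 - p)] (mod int p)"
  proof -
    have k: "2 * c - 1 - p = p - 1 - b + (n + m)" using assms by (auto simp: n_def m_def)
    have "2 * c - n - m = p + (p - 1 - b + 1)" using assms by (auto simp: n_def m_def)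
    then have "[int (2 * c - n - m) = 1 + of_nat (p - 1 - b)] (mod int p)"
      by (simp add: cong_iff_dvd_diff)
    then have "[Q * fact (p - 1 - b) = pochhammer (1 + of_nat (p - 1 - b)) (n + m) * fact (p - 1 - b)] (mod int p)"
      unfolding Q_def by (intro cong_mult cong_refl pochhammer_cong)
    also have "pochhammer (1 + of_nat (p - 1 - b)) (n + m) * fact (p - 1 - b) = (fact (2 * c - 1 - p) :: int)"
      unfolding pochhammer_fact k pochhammer_product'[of "1::int"] by (rule mult.commute)
    finally show ?thesis .
  qed
  have W: "[fact a * fact n = (- 1) ^ Suc a] (mod int p)" "[fact b * fact (p - 1 - b) = (- 1) ^ Suc b] (mod int p)"
     "[fact X * fact (p - 1 - X) = (- 1) ^ Suc X] (mod int p)" "[fact Y * fact (p - 1 - Y) = (- 1) ^ Suc Y] (mod int p)"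
    unfolding n_def by (intro wilson_pair p a b lt)+
  let ?L = "S_coeff p a b c 1 3 * (fact (c - 1) * (fact X * fact m))"
  let ?R = "fact (2 * c - 1 - p) * (fact a * fact (a + c - p) * fact b * fact Y)"
  \<comment> \<open>Replacing the three signs by Wilson products supplies the factors
    \<open>fact n\<close> and \<open>fact (p - 1 - Y)\<close> for \<open>D\<close> and
    \<open>fact (p - 1 - b)\<close> for \<open>Qc\<close>.\<close>
  have "[(- 1) ^ Suc a * (- 1) ^ Suc b * (- 1) ^ Suc Y * ?L
     = (fact a * fact n) * (fact b * fact (p - 1 - b)) * (fact Y * fact (p - 1 - Y)) *
       ((- 1) ^ b * T * (fact (c - 1) * (fact X * fact m)))] (mod int p)"
    by (intro cong_mult cong_refl S W[THEN cong_sym])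
  also have "(fact a * fact n) * (fact b * fact (p - 1 - b)) * (fact Y * fact (p - 1 - Y)) *
       ((- 1) ^ b * T * (fact (c - 1) * (fact X * fact m)))
     = (- 1) ^ b * (T * (fact n * fact m * fact (c - 1) * fact (p - 1 - Y))) *
       (fact a * fact b * fact Y * fact X * fact (p - 1 - b))"
    by (simp only: mult_ac)
  also have "\<dots> = (- 1) ^ b * (fact X * fact (p - 1 - X)) * (Q * fact (p - 1 - b)) *
     (fact a * fact (a + c - p) * fact b * fact Y)"
    unfolding D by (simp only: mult_ac)
  also have "[\<dots> = (- 1) ^ b * (- 1) ^ Suc X * fact (2 * c - 1 - p) *
     (fact a * fact (a + c - p) * fact b * fact Y)] (mod int p)"
    by (intro cong_mult cong_refl Qc W)
  also have "(- 1) ^ b * (- 1) ^ Suc X * fact (2 * c - 1 - p) *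
     (fact a * fact (a + c - p) * fact b * fact Y) = (- 1) ^ b * (- 1) ^ Suc X * ?R"
    by (simp only: mult.assoc)
  \<comment> \<open>Both exponents have the parity of \<open>a + c\<close>. Oddness of
    \<open>p\<close> enters through \<open>Y + p = b + c\<close>.\<close>
  also have "(- 1 :: int) ^ b * (- 1) ^ Suc X = (- 1) ^ Suc a * (- 1) ^ Suc b * (- 1) ^ Suc Y"
  proof -
    have "X + 2 * p = a + b + c + 1" "Y + p = b + c" using assms by (auto simp: X_def Y_def)
    then have "even X = even (a + b + c + 1)" "even Y = even (b + c + 1)"
      using p(2) by presburger+
    then show ?thesis by (auto simp: minus_one_power_iff)
  qed
  finally have "[(- 1) ^ Suc a * (- 1) ^ Suc b * (- 1) ^ Suc Y * ?L =
      (- 1) ^ Suc a * (- 1) ^ Suc b * (- 1) ^ Suc Y * ?R] (mod int p)" .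
  then have "[?L = ?R] (mod int p)"
    by (subst (asm) cong_mult_lcancel) auto
  then show ?thesis by (simp only: X_def Y_def m_def)
qed

theorem theorem3p10:
  fixes p a b c :: nat
  assumes "prime p" and "odd p"
    and "0 < a" "a < p" and "0 < b" "b < p" and "0 < c" "c < p"
  shows
    "(a + b + 2 * c < 3 * p - 1 \<longrightarrow> S_coeff p a b c 1 3 = 0) \<and>
     (2 * c < p \<longrightarrow> S_coeff p a b c 1 3 = 0) \<and>
     (a + b + 2 * c \<ge> 3 * p - 1 \<longrightarrow>
        S_bar p a b c 1 3 =
          (fact_F p (2 * c - 1 - p) \<oslash>\<^bsub>F p\<^esub> fact_F p (c - 1)) \<otimes>\<^bsub>F p\<^esub>
          ((fact_F p a \<otimes>\<^bsub>F p\<^esub> fact_F p (a + c - p) \<otimes>\<^bsub>F p\<^esub>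
            fact_F p b \<otimes>\<^bsub>F p\<^esub> fact_F p (b + c - p)) \<oslash>\<^bsub>F p\<^esub>
           (fact_F p (a + b + c + 1 - 2 * p) \<otimes>\<^bsub>F p\<^esub>
            fact_F p (a + b + 2 * c + 1 - 3 * p))))"
proof -
  have vanish: "S_coeff p a b c 1 3 = 0" if "a + b + 2 * c < 3 * p - 1"
  proof -
    \<comment> \<open>The lower entry of the last binomial exceeds \<open>b\<close> for every
      \<open>i\<close>, so each summand is zero.\<close>
    have "b < 3 * p - 1 - a - 2 * c + i" for i using that by linarith
    then show ?thesis using S_coeff_1_3[of a p c b] assms by (simp add: binomial_eq_0)
  qed
  \<comment> \<open>Here \<open>a + b \<le> 2p - 2\<close>, so the sum stays below
    \<open>3p - 1\<close>.\<close>
  have small: "S_coeff p a b c 1 3 = 0" if "2 * c < p"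
    by (rule vanish) (use that assms in linarith)
  have main: "S_bar p a b c 1 3 =
          (fact_F p (2 * c - 1 - p) \<oslash>\<^bsub>F p\<^esub> fact_F p (c - 1)) \<otimes>\<^bsub>F p\<^esub>
          ((fact_F p a \<otimes>\<^bsub>F p\<^esub> fact_F p (a + c - p) \<otimes>\<^bsub>F p\<^esub>
            fact_F p b \<otimes>\<^bsub>F p\<^esub> fact_F p (b + c - p)) \<oslash>\<^bsub>F p\<^esub>
           (fact_F p (a + b + c + 1 - 2 * p) \<otimes>\<^bsub>F p\<^esub>
            fact_F p (a + b + 2 * c + 1 - 3 * p)))" (is "_ = (?A \<oslash>\<^bsub>_\<^esub> ?B) \<otimes>\<^bsub>_\<^esub> (?C \<oslash>\<^bsub>_\<^esub> ?D)")
    if ge: "a + b + 2 * c \<ge> 3 * p - 1"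
  proof -
    let ?N = "fact a * fact (a + c - p) * fact b * fact (b + c - p) :: int"
    let ?M = "fact (a + b + c + 1 - 2 * p) * fact (a + b + 2 * c + 1 - 3 * p) :: int"
    have mult: "x \<otimes>\<^bsub>F p\<^esub> y = x * y mod int p" for x y by (simp add: residue_ring_def)
    have A: "[?A = fact (2 * c - 1 - p)] (mod int p)" and B: "[?B = fact (c - 1)] (mod int p)"
      by (simp_all add: fact_F_def reduce_def)
    have C: "?C = ?N mod int p" and D: "?D = ?M mod int p"
      unfolding fact_F_def reduce_def mult by (simp_all add: mod_simps)
    have p0: "0 < int p" using assms by simp
    \<comment> \<open>All factorials in the denominators have arguments below \<open>p\<close>,
      hence are units modulo \<open>p\<close>.\<close>
    have nB: "\<not> int p dvd fact (c - 1)" using assms by (intro not_dvd_fact_int) auto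
    have nM: "\<not> int p dvd ?M"
      using assms not_dvd_fact_int[of p "a + b + c + 1 - 2 * p"]
        not_dvd_fact_int[of p "a + b + 2 * c + 1 - 3 * p"]
      by (auto simp: prime_dvd_mult_iff)
    have qB: "[(?A \<oslash>\<^bsub>F p\<^esub> ?B) * ?B = ?A] (mod int p)"
      using nB p0 assms(1) by (intro quot_residue_ring) (simp_all add: fact_F_def reduce_def dvd_mod_iff)
    have qD: "[(?C \<oslash>\<^bsub>F p\<^esub> ?D) * ?D = ?C] (mod int p)"
      using nM p0 assms(1) unfolding D by (intro quot_residue_ring) (simp_all add: dvd_mod_iff)
    \<comment> \<open>The claimed value \<open>?q\<close> is compared with the coefficient after
      multiplication by the common denominator, which is then cancelled.\<close>
    let ?q = "(?A \<oslash>\<^bsub>F p\<^esub> ?B) * (?C \<oslash>\<^bsub>F p\<^esub> ?D)"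
    have "[?q * (fact (c - 1) * ?M) = ?q * (?B * ?D)] (mod int p)"
      unfolding D by (intro cong_mult cong_refl B[THEN cong_sym]) simp
    also have "?q * (?B * ?D) = ((?A \<oslash>\<^bsub>F p\<^esub> ?B) * ?B) * ((?C \<oslash>\<^bsub>F p\<^esub> ?D) * ?D)"
      by (simp only: mult_ac)
    also have "[\<dots> = ?A * ?C] (mod int p)" by (intro cong_mult qB qD)
    also have "[?A * ?C = fact (2 * c - 1 - p) * ?N] (mod int p)"
      unfolding C by (intro cong_mult A) simp
    also have "[fact (2 * c - 1 - p) * ?N = S_coeff p a b c 1 3 * (fact (c - 1) * ?M)] (mod int p)"
      using assms ge by (intro S_coeff_1_3_fact_cong[THEN cong_sym])
    finally have "[?q * (fact (c - 1) * ?M) = S_coeff p a b c 1 3 * (fact (c - 1) * ?M)] (mod int p)" .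
    moreover have "coprime (fact (c - 1) * ?M) (int p)"
      using nB nM assms(1) prime_imp_coprime[of "int p" "fact (c - 1) * ?M"]
      by (simp add: prime_dvd_mult_iff coprime_commute)
    ultimately have "[?q = S_coeff p a b c 1 3] (mod int p)"
      using cong_mult_rcancel by blast
    then show ?thesis by (simp add: S_bar_def reduce_def mult cong_def)
  qed
  show ?thesis using vanish small main by blast
qed

end
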